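(* Let $0\leqslant\alpha<1$, $\beta>0$ and let $n\geqslant 1$ be an integer. Let $\mathcal{F}_{\alpha,\beta,n}$ be the family of all functions $F(z)=f(z)(Q(z))^{\beta/n}$ on $\mathbb{D}$, where $f\in\mathcal{ST}(\alpha)$ and $Q$ is a polynomial of degree $n$ with $Q(0)=1$ and all zeros in $\mathbb{C}\setminus\mathbb{D}$. Then the $\mathcal{S}^{*}_{SG}$-radius of this family, that is, the largest $R\in(0,1)$ such that $z\mapsto r^{-1}F(rz)$ belongs to $\mathcal{S}^{*}_{SG}$ for all $F\in\mathcal{F}_{\alpha,\beta,n}$ and all $0<r<R$, is \[R_{\mathcal{S}^{*}_{SG}}(F)=\begin{cases}\sigma_0 & \text{if } 2\alpha+\beta-2\geqslant 0,\\ \tilde{\sigma}_0 & \text{if } 2\alpha+\beta-2<0,\end{cases}\] where \[\sigma_0=\dfrac{2(e-1)}{(2-2\alpha+\beta)(e+1)+\sqrt{((e+1)(2-2\alpha+\beta))^2-4(e-1)(3+e-2\alpha-2\alpha e-\beta-\beta e)}}\] and \[\tilde{\sigma}_0=\dfrac{2(e-1)}{(2-2\alpha+\beta)(e+1)+\sqrt{((e+1)(2-2\alpha+\beta))^2+4(e-1)(1+3e-2\alpha-2\alpha e-\beta-\beta e)}}.\]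
   Context: $\mathbb{D}=\{z\in\mathbb{C}:|z|<1\}$. $\mathcal{A}$ is the class of analytic functions $f$ on $\mathbb{D}$ with $f(0)=0$, $f'(0)=1$. For $0\leqslant\alpha<1$, $\mathcal{ST}(\alpha)$ (starlike functions of order $\alpha$) is the class of $f\in\mathcal{A}$ with $\operatorname{Re}(zf'(z)/f(z))>\alpha$ for all $z\in\mathbb{D}$ (the quotient being given the value $1$ at $z=0$). For analytic $g,h$ on $\mathbb{D}$, $g\prec h$ (subordination) means $g=h\circ w$ for some analytic $w:\mathbb{D}\to\mathbb{D}$ with $w(0)=0$. $\mathcal{S}^{*}_{SG}$ (starlike functions associated with the modified sigmoid function) is the class of $f\in\mathcal{A}$ with $zf'(z)/f(z)\prec 2/(1+e^{-z})$; the image of $\mathbb{D}$ under $2/(1+e^{-z})$ is $\{w:|\log(w/(2-w))|<1\}$. Since $Q$ is non-vanishing in $\mathbb{D}$ and $Q(0)=1$, $(Q(z))^{\beta/n}$ denotes the analytic branch on $\mathbb{D}$ equal to $1$ at $z=0$, so $F\in\mathcal{A}$. Here $e$ is Euler's number. *)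

theory Defs
  imports "HOL-Complex_Analysis.Complex_Analysis" "HOL-Computational_Algebra.Polynomial"
begin

text \<open>
  Functions on the unit disc are total functions of type \<^typ>\<open>complex \<Rightarrow> complex\<close>; only their
  values on the disc matter.
\<close>

abbreviation unit_disc :: "complex set" where
  "unit_disc \<equiv> ball 0 1"

definition class_A :: "(complex \<Rightarrow> complex) set" where
  "class_A = {f. f holomorphic_on unit_disc \<and> f 0 = 0 \<and> deriv f 0 = 1}"

definition starlike_quotient :: "(complex \<Rightarrow> complex) \<Rightarrow> complex \<Rightarrow> complex" where
  "starlike_quotient f z = (if z = 0 then 1 else z * deriv f z / f z)"

text \<open>
  A zero of \<open>f\<close> in the punctured disc is excluded by the condition below: there the quotient
  is \<open>0\<close> by the convention for division by zero, and \<open>\<alpha> \<ge> 0\<close>.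
\<close>

definition starlike_of_order :: "real \<Rightarrow> (complex \<Rightarrow> complex) set" where
  "starlike_of_order \<alpha> =
     {f \<in> class_A. \<forall>z\<in>unit_disc. Re (starlike_quotient f z) > \<alpha>}"

definition subordinate :: "(complex \<Rightarrow> complex) \<Rightarrow> (complex \<Rightarrow> complex) \<Rightarrow> bool" where
  "subordinate g h \<longleftrightarrow>
     g holomorphic_on unit_disc \<and> h holomorphic_on unit_disc \<and>
     (\<exists>w. w holomorphic_on unit_disc \<and> w ` unit_disc \<subseteq> unit_disc \<and> w 0 = 0 \<and>
          (\<forall>z\<in>unit_disc. g z = h (w z)))"

text \<open>
  Here a zero of \<open>f\<close> in the punctured disc is excluded because the quotient has a pole there
  and so is not holomorphic, whatever value it is given at that point.
\<close>

definition starlike_SG :: "(complex \<Rightarrow> complex) set" where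
  "starlike_SG = {f \<in> class_A. subordinate (starlike_quotient f) (\<lambda>z. 2 / (1 + exp (- z)))}"

text \<open>
  \<open>p\<close> is the analytic branch of \<open>q\<^sup>c\<close> on the disc with \<open>p 0 = 1\<close>: a branch of the power is
  \<open>exp (c * L)\<close> for an analytic branch \<open>L\<close> of \<open>log q\<close>. Another \<open>L\<close> changes \<open>p\<close> by a constant factor
  only, so \<open>p\<close> is determined on the disc by its value at \<open>0\<close>. (The principal
  \<open>powr\<close> would not do, as \<open>q\<close> may cross the negative real axis.)
\<close>

definition power_branch ::
  "(complex \<Rightarrow> complex) \<Rightarrow> real \<Rightarrow> (complex \<Rightarrow> complex) \<Rightarrow> bool" where
  "power_branch q c p \<longleftrightarrow>
     (\<exists>L. L holomorphic_on unit_disc \<and>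
          (\<forall>z\<in>unit_disc. exp (L z) = q z \<and> p z = exp (of_real c * L z))) \<and>
     p 0 = 1"

definition family_F :: "real \<Rightarrow> real \<Rightarrow> nat \<Rightarrow> (complex \<Rightarrow> complex) set" where
  "family_F \<alpha> \<beta> n =
     {F. \<exists>f Q p. f \<in> starlike_of_order \<alpha> \<and>
           degree Q = n \<and> poly Q 0 = 1 \<and> (\<forall>z. poly Q z = 0 \<longrightarrow> z \<notin> unit_disc) \<and>
           power_branch (poly Q) (\<beta> / real n) p \<and>
           (\<forall>z\<in>unit_disc. F z = f z * p z)}"

definition is_class_radius ::
  "(complex \<Rightarrow> complex) set \<Rightarrow> (complex \<Rightarrow> complex) set \<Rightarrow> real \<Rightarrow> bool" where
  "is_class_radius \<C> \<F> R \<longleftrightarrow>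
     (let admissible = {R. 0 < R \<and> R < 1 \<and>
            (\<forall>F\<in>\<F>. \<forall>r. 0 < r \<and> r < R \<longrightarrow>
               (\<lambda>z. inverse (of_real r) * F (of_real r * z)) \<in> \<C>)}
      in R \<in> admissible \<and> (\<forall>R'\<in>admissible. R' \<le> R))"

end

theory Submission imports Defs "HOL-Computational_Algebra.Fundamental_Theorem_Algebra" begin

text \<open>
  Write \<open>S\<^sub>F = z F'/F = S\<^sub>f + (\<beta>/n) z Q'/Q\<close>. For \<open>\<bar>z\<bar> = r < 1\<close>, the Schwarz lemma confines \<open>S\<^sub>f\<close> to a disc,
  and each linear factor of \<open>Q\<close> confines its share of \<open>z Q'/Q\<close> to one; adding them up gives
  \<open>\<bar>S\<^sub>F - 1\<bar> \<le> (c r + m r\<^sup>2) / (1 - r\<^sup>2)\<close> with \<open>c = 2 - 2 \<alpha> + \<beta>\<close> and \<open>m = \<bar>2 - 2 \<alpha> - \<beta>\<bar>\<close>.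
  The image of the unit disc under \<open>2 / (1 + e\<^sup>-\<^sup>z)\<close> contains the disc of centre 1 and radius
  \<open>(e - 1) / (e + 1)\<close>, and the bound stays below this radius exactly for \<open>r\<close> below the positive root
  of a quadratic, which is \<open>\<sigma>\<^sub>0\<close> or \<open>\<sigma>\<^sub>1\<close> according to the sign inside \<open>m\<close>. For
  \<open>f = z / (1 - z)^(2 - 2 \<alpha>)\<close> and \<open>Q = (1 + z)^n\<close>, equality holds at a real point of modulus \<open>r\<close>,
  and at the root \<open>S\<^sub>F\<close> takes there the value of the sigmoid at \<open>1\<close> or \<open>-1\<close>.
\<close>

section \<open>The image of the unit disc under the sigmoid\<close>

text \<open>Even powers cancel between the two series and odd powers double, so the norm of each
  term at \<open>u\<close> equals the term at \<open>norm u\<close>.\<close>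

lemma norm_Ln_quotient_le:
  fixes u :: complex
  assumes "norm u < 1"
  shows "norm (Ln (1 + u) - Ln (1 - u)) \<le> ln (1 + norm u) - ln (1 - norm u)"
proof (rule norm_sums_le)
  have "(\<lambda>n. - ((- u) ^ n) / of_nat n - (- ((- (- u)) ^ n) / of_nat n)) sums (Ln (1 + u) - Ln (1 + (- u)))"
    by (intro sums_diff Ln_series') (use assms in auto)
  then show "(\<lambda>n. (u ^ n - (- u) ^ n) / of_nat n) sums (Ln (1 + u) - Ln (1 - u))"
    by (simp add: diff_divide_distrib)
  let ?x = "norm u"
  have "(\<lambda>n. - ((- ?x) ^ n) / of_nat n - (- ((- (- ?x)) ^ n) / of_nat n)) sums (ln (1 + ?x) - ln (1 + (- ?x)))"
    by (intro sums_diff ln_series') (use assms in auto)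
  then show "(\<lambda>n. (?x ^ n - (- ?x) ^ n) / of_nat n) sums (ln (1 + ?x) - ln (1 - ?x))"
    by (simp add: diff_divide_distrib)
next
  fix n
  show "norm ((u ^ n - (- u) ^ n) / of_nat n) \<le> (norm u ^ n - (- norm u) ^ n) / of_nat n"
  proof (cases "even n")
    case False
    then have "u ^ n - (- u) ^ n = 2 * u ^ n" "norm u ^ n - (- norm u) ^ n = 2 * norm u ^ n"
      by simp_all
    then show ?thesis
      by (simp only: norm_divide norm_mult norm_power) simp
  qed simp
qed

text \<open>The denominator vanishes only at odd multiples of pi i; already
  \<open>\<bar>Im z\<bar> < 1 < pi / 2\<close> keeps its real part positive.\<close>

lemma holomorphic_sigmoid: "(\<lambda>z. 2 / (1 + exp (- z))) holomorphic_on unit_disc"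
proof (intro holomorphic_intros)
  fix z :: complex
  assume "z \<in> unit_disc"
  then have "\<bar>Im z\<bar> < 1"
    using abs_Im_le_cmod[of z] by simp
  then have "cos (Im z) > 0"
    using pi_gt3 by (intro cos_gt_zero_pi) linarith+
  then have "Re (1 + exp (- z)) > 0"
    by (simp add: Re_exp add_pos_pos)
  then show "1 + exp (- z) \<noteq> 0"
    by force
qed

lemma exp_one_quotient_less_one: "(exp 1 - 1) / (exp 1 + 1) < (1::real)"
  by (simp add: add_pos_pos field_simps)

text \<open>
  Writing \<open>2 / (1 + e\<^sup>-\<^sup>w) = 1 + u\<close> gives \<open>w = ln ((1 + u) / (1 - u))\<close>, whose Taylor coefficients
  in \<open>u\<close> are nonnegative, so that \<open>\<bar>w\<bar> < 1\<close> as soon as \<open>\<bar>u\<bar> < tanh (1/2) = (e - 1) / (e + 1)\<close>.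
\<close>

lemma subordinate_sigmoidI:
  assumes hol: "g holomorphic_on unit_disc" and "g 0 = 1"
    and bound: "\<And>z. z \<in> unit_disc \<Longrightarrow> norm (g z - 1) < (exp 1 - 1) / (exp 1 + 1)"
  shows "subordinate g (\<lambda>z. 2 / (1 + exp (- z)))"
proof -
  \<comment> \<open>A difference of two logarithms: both arguments stay in the right half-plane, off
    the branch cut.\<close>
  define w where "w z = Ln (1 + (g z - 1)) - Ln (1 - (g z - 1))" for z
  have lt1: "norm (g z - 1) < 1" if "z \<in> unit_disc" for z
    using bound[OF that] exp_one_quotient_less_one by linarith
  have re: "Re (1 + (g z - 1)) > 0" "Re (1 - (g z - 1)) > 0" if "z \<in> unit_disc" for z
    using lt1[OF that] abs_Re_le_cmod[of "g z - 1"] by auto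
  have hw: "w holomorphic_on unit_disc"
    unfolding w_def using re
    by (intro holomorphic_intros hol) (force simp: complex_nonpos_Reals_iff)+
  have "norm (w z) < 1" if z: "z \<in> unit_disc" for z
  proof -
    let ?x = "norm (g z - 1)"
    have x: "?x * (exp 1 + 1) < exp 1 - 1"
      using bound[OF z] by (simp add: field_simps add_pos_pos)
    have "norm (w z) \<le> ln (1 + ?x) - ln (1 - ?x)"
      unfolding w_def by (rule norm_Ln_quotient_le[OF lt1[OF z]])
    also have "\<dots> = ln ((1 + ?x) / (1 - ?x))"
      using lt1[OF z] by (intro ln_divide_pos [symmetric] add_pos_nonneg) auto
    also have "\<dots> < ln (exp 1)"
    proof (subst ln_less_cancel_iff)
      show "(1 + ?x) / (1 - ?x) < exp 1"
        using lt1[OF z] x by (simp add: field_simps)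
    qed (use lt1[OF z] in \<open>auto intro!: divide_pos_pos add_pos_nonneg\<close>)
    finally show ?thesis
      by simp
  qed
  moreover have "g z = 2 / (1 + exp (- w z))" if z: "z \<in> unit_disc" for z
  proof -
    have nz: "1 + (g z - 1) \<noteq> 0" "1 - (g z - 1) \<noteq> 0"
      using re[OF z] by force+
    have "exp (- w z) = exp (Ln (1 - (g z - 1))) / exp (Ln (1 + (g z - 1)))"
      by (simp add: w_def flip: exp_diff)
    also have "\<dots> = (1 - (g z - 1)) / (1 + (g z - 1))"
      using nz by simp
    finally have "1 + exp (- w z) = 2 / g z"
      using nz by (simp add: field_simps)
    then show ?thesis
      by simp
  qed
  moreover have "w 0 = 0"
    using \<open>g 0 = 1\<close> by (simp add: w_def)
  ultimately show ?thesis
    unfolding subordinate_def using hw hol holomorphic_sigmoid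
    by (intro conjI exI[of _ w]) auto
qed

text \<open>A value of the sigmoid determines \<open>exp (- a)\<close>, hence \<open>a\<close> only
  up to periods. Its norm still fixes \<open>Re a\<close>, and no point of the open disc has real
  part 1 or -1.\<close>

lemma not_subordinate_sigmoid:
  assumes "z \<in> unit_disc" "g z = 2 / (1 + exp (- a))" "\<bar>Re a\<bar> = 1"
  shows "\<not> subordinate g (\<lambda>z. 2 / (1 + exp (- z)))"
proof
  assume "subordinate g (\<lambda>z. 2 / (1 + exp (- z)))"
  then obtain b where b: "b \<in> unit_disc" "g z = 2 / (1 + exp (- b))"
    unfolding subordinate_def using assms(1) by blast
  then have "exp (- b) = exp (- a)"
    using assms(2) by (metis add_left_cancel divide_cancel_left zero_neq_numeral)
  then have "norm (exp (- b)) = norm (exp (- a))"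
    by simp
  then have "Re b = Re a"
    by simp
  then show False
    using b(1) assms(3) abs_Re_le_cmod[of b] by simp
qed

section \<open>Holomorphy of the starlike quotient\<close>

text \<open>The common zero at 0 is divided out: \<open>g\<close> is \<open>f z / z\<close> with its
  removable singularity filled. It has no zeros, and \<open>deriv f z / g z\<close> takes the
  conventional value 1 at 0.\<close>

lemma holomorphic_starlike_quotient:
  assumes f: "f \<in> class_A" and nz: "\<forall>z\<in>unit_disc - {0}. f z \<noteq> 0"
  shows "starlike_quotient f holomorphic_on unit_disc"
proof -
  define g where "g z = (if z = 0 then deriv f 0 else (f z - f 0) / (z - 0))" for z
  have hol: "f holomorphic_on unit_disc" and f0: "f 0 = 0" "deriv f 0 = 1"
    using f by (auto simp: class_A_def)
  have "g holomorphic_on unit_disc"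
    unfolding g_def by (rule pole_lemma[OF hol]) simp
  moreover have "g z \<noteq> 0" if "z \<in> unit_disc" for z
    using nz that f0 by (auto simp: g_def)
  ultimately have "(\<lambda>z. deriv f z / g z) holomorphic_on unit_disc"
    by (intro holomorphic_intros holomorphic_deriv hol) auto
  then show ?thesis
    by (rule holomorphic_transform) (auto simp: starlike_quotient_def g_def f0)
qed

lemma starlike_of_order_nonzero:
  assumes "f \<in> starlike_of_order \<alpha>" "0 \<le> \<alpha>"
  shows "\<forall>z\<in>unit_disc - {0}. f z \<noteq> 0"
  using assms by (force simp: starlike_of_order_def starlike_quotient_def)

section \<open>The disc containing the quotient of a starlike function\<close>

text \<open>The Moebius map sends the disc of radius \<open>r\<close> to the disc with diameter from
  (1 - r)/(1 + r) to (1 + r)/(1 - r), whose midpoint and half-length appear here.\<close>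

lemma norm_moebius_le:
  fixes \<phi> :: complex and r :: real
  assumes "norm \<phi> \<le> r" "r < 1"
  shows "norm ((1 + \<phi>) / (1 - \<phi>) - of_real ((1 + r\<^sup>2) / (1 - r\<^sup>2))) \<le> 2 * r / (1 - r\<^sup>2)"
proof -
  have r: "0 \<le> r"
    using assms(1) norm_ge_zero order_trans by blast
  then have r2: "r\<^sup>2 < 1"
    using assms by (simp add: abs_square_less_1)
  have "complex_of_real (1 - r\<^sup>2) \<noteq> 0"
    using r2 by (simp only: of_real_eq_0_iff)
  then have nz: "1 - \<phi> \<noteq> 0" "1 - complex_of_real r ^ 2 \<noteq> 0"
    using assms by auto
  have "(norm \<phi>)\<^sup>2 \<le> r\<^sup>2"
    using assms r by (intro power_mono) auto
  \<comment> \<open>Clearing denominators reduces the claim to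
    \<open>norm (\<phi> - r\<^sup>2) \<le> r * norm (1 - \<phi>)\<close>; this product is the
    difference of the squares of the two sides.\<close>
  then have "0 \<le> (1 - r\<^sup>2) * (r\<^sup>2 - (norm \<phi>)\<^sup>2)"
    using r2 by (intro mult_nonneg_nonneg) auto
  also have "\<dots> = (r * norm (1 - \<phi>))\<^sup>2 - (norm (\<phi> - of_real (r\<^sup>2)))\<^sup>2"
    unfolding power_mult_distrib cmod_power2 by (simp add: power2_eq_square algebra_simps)
  finally have *: "norm (\<phi> - of_real (r\<^sup>2)) \<le> r * norm (1 - \<phi>)"
    using r by - (rule power2_le_imp_le, simp_all)
  have "(1 + \<phi>) / (1 - \<phi>) - of_real ((1 + r\<^sup>2) / (1 - r\<^sup>2))
      = ((1 + \<phi>) * (1 - of_real r ^ 2) - (1 + of_real r ^ 2) * (1 - \<phi>)) / ((1 - \<phi>) * of_real (1 - r\<^sup>2))"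
    using nz by (simp add: diff_frac_eq)
  also have "(1 + \<phi>) * (1 - of_real r ^ 2) - (1 + of_real r ^ 2) * (1 - \<phi>) = 2 * (\<phi> - of_real (r\<^sup>2))"
    by (simp add: algebra_simps)
  finally have "norm ((1 + \<phi>) / (1 - \<phi>) - of_real ((1 + r\<^sup>2) / (1 - r\<^sup>2)))
      = 2 * norm (\<phi> - of_real (r\<^sup>2)) / (norm (1 - \<phi>) * (1 - r\<^sup>2))"
    by (simp only: norm_divide norm_mult norm_of_real norm_numeral) (use r2 in simp)
  also have "\<dots> \<le> 2 * (r * norm (1 - \<phi>)) / (norm (1 - \<phi>) * (1 - r\<^sup>2))"
    using * r2 by (intro divide_right_mono mult_left_mono mult_nonneg_nonneg) auto
  also have "\<dots> = 2 * r / (1 - r\<^sup>2)"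
    using nz by simp
  finally show ?thesis .
qed

text \<open>The Cayley transform \<open>\<phi>\<close> of \<open>p\<close> maps the disc into itself
  and fixes 0, so the Schwarz lemma bounds it by \<open>norm z\<close>; inverting the transform
  gives the disc for \<open>p\<close>.\<close>

lemma positive_real_part_disc:
  assumes hol: "p holomorphic_on unit_disc" and p0: "p 0 = 1"
    and pos: "\<And>z. z \<in> unit_disc \<Longrightarrow> Re (p z) > 0" and z: "z \<in> unit_disc"
  defines "r \<equiv> norm z"
  shows "norm (p z - of_real ((1 + r\<^sup>2) / (1 - r\<^sup>2))) \<le> 2 * r / (1 - r\<^sup>2)"
proof -
  define \<phi> where "\<phi> z = (p z - 1) / (p z + 1)" for z
  have nz: "p z + 1 \<noteq> 0" if "z \<in> unit_disc" for z
    using pos[OF that] by (metis add_pos_pos less_irrefl one_complex.sel(1) plus_complex.sel(1) zero_complex.sel(1) zero_less_one)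
  have lt1: "norm (\<phi> z) < 1" if "norm z < 1" for z
  proof -
    have "Re (p z) > 0"
      using pos that by simp
    then have "(norm (p z - 1))\<^sup>2 < (norm (p z + 1))\<^sup>2"
      unfolding cmod_power2 by (simp add: power2_eq_square algebra_simps)
    then have "norm (p z - 1) < norm (p z + 1)"
      by (rule power2_less_imp_less) simp
    then show ?thesis
      using nz that by (simp add: \<phi>_def norm_divide divide_simps)
  qed
  have "\<phi> holomorphic_on unit_disc"
    unfolding \<phi>_def using nz by (intro holomorphic_intros hol) auto
  then have "norm (\<phi> z) \<le> norm z"
    by (rule Schwarz_Lemma(1)) (use lt1 z p0 in \<open>auto simp: \<phi>_def\<close>)
  moreover have "p z = (1 + \<phi> z) / (1 - \<phi> z)"
    using nz[OF z] by (simp add: \<phi>_def divide_simps)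
  ultimately show ?thesis
    unfolding r_def using norm_moebius_le[of "\<phi> z" "norm z"] z by simp
qed

text \<open>Rescaling the half-plane Re > \<alpha> to Re > 0, with 1 kept fixed, reduces this to
  functions of positive real part.\<close>

lemma starlike_of_order_disc:
  assumes f: "f \<in> starlike_of_order \<alpha>" and \<alpha>: "0 \<le> \<alpha>" "\<alpha> < 1" and z: "z \<in> unit_disc"
  defines "r \<equiv> norm z"
  shows "norm (starlike_quotient f z - 1 - of_real (2 * (1 - \<alpha>) * r\<^sup>2 / (1 - r\<^sup>2)))
    \<le> 2 * (1 - \<alpha>) * r / (1 - r\<^sup>2)"
proof -
  define p where "p z = (starlike_quotient f z - of_real \<alpha>) / of_real (1 - \<alpha>)" for z
  have r2: "r\<^sup>2 < 1"
    using z by (simp add: r_def abs_square_less_1)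
  have "starlike_quotient f holomorphic_on unit_disc"
    using f \<alpha> starlike_of_order_nonzero[OF f \<alpha>(1)]
    by (intro holomorphic_starlike_quotient) (auto simp: starlike_of_order_def)
  then have hol: "p holomorphic_on unit_disc"
    unfolding p_def using \<alpha> by (intro holomorphic_intros) auto
  have p0: "p 0 = 1"
    using \<alpha> by (simp add: p_def starlike_quotient_def)
  have pos: "Re (p z) > 0" if "z \<in> unit_disc" for z
    unfolding p_def Re_divide_of_real using f that \<alpha> by (simp add: starlike_of_order_def)
  define k where "k = (1 + r\<^sup>2) / (1 - r\<^sup>2)"
  have k: "2 * (1 - \<alpha>) * r\<^sup>2 / (1 - r\<^sup>2) = (1 - \<alpha>) * (k - 1)"
    using r2 by (simp add: k_def field_simps)
  have "starlike_quotient f z = of_real \<alpha> + of_real (1 - \<alpha>) * p z"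
    using \<alpha> by (simp add: p_def)
  then have "starlike_quotient f z - 1 - of_real (2 * (1 - \<alpha>) * r\<^sup>2 / (1 - r\<^sup>2))
     = of_real (1 - \<alpha>) * (p z - of_real k)"
    unfolding k by (simp add: algebra_simps)
  then have "norm (starlike_quotient f z - 1 - of_real (2 * (1 - \<alpha>) * r\<^sup>2 / (1 - r\<^sup>2)))
     = (1 - \<alpha>) * norm (p z - of_real k)"
    using \<alpha> by (simp only: norm_mult norm_of_real)
  also have "\<dots> \<le> (1 - \<alpha>) * (2 * r / (1 - r\<^sup>2))"
    unfolding k_def r_def using \<alpha> by (intro mult_left_mono positive_real_part_disc[OF hol p0 pos z]) auto
  finally show ?thesis
    by (simp add: mult_ac)
qed

section \<open>The disc containing the logarithmic derivative of a polynomial\<close>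

text \<open>Over a common denominator the numerator is \<open>z * (1 - cnj z * \<zeta>)\<close>. As
  \<open>\<zeta>\<close> lies outside the open disc, the Blaschke inequality bounds the bracket by
  \<open>norm (z - \<zeta>)\<close>.\<close>

lemma log_derivative_factor_disc:
  fixes z \<zeta> :: complex
  assumes \<zeta>: "norm \<zeta> \<ge> 1" and z: "norm z < 1"
  defines "r \<equiv> norm z"
  shows "norm (z / (z - \<zeta>) + of_real (r\<^sup>2 / (1 - r\<^sup>2))) \<le> r / (1 - r\<^sup>2)"
proof -
  have r2: "r\<^sup>2 < 1"
    using z by (simp add: r_def abs_square_less_1)
  have "complex_of_real (1 - r\<^sup>2) \<noteq> 0"
    using r2 by (simp only: of_real_eq_0_iff)
  then have nz: "z - \<zeta> \<noteq> 0" "1 - complex_of_real r ^ 2 \<noteq> 0"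
    using \<zeta> z by auto
  have zz: "complex_of_real r ^ 2 = z * cnj z"
    using complex_norm_square[of z] by (simp add: r_def)
  have "1 \<le> (norm \<zeta>)\<^sup>2"
    using \<zeta> by (simp add: one_le_power)
  then have "0 \<le> ((norm \<zeta>)\<^sup>2 - 1) * (1 - r\<^sup>2)"
    using r2 by (intro mult_nonneg_nonneg) auto
  also have "\<dots> = (norm (z - \<zeta>))\<^sup>2 - (norm (1 - cnj z * \<zeta>))\<^sup>2"
    unfolding r_def cmod_power2 by (simp add: power2_eq_square algebra_simps)
  finally have *: "norm (1 - cnj z * \<zeta>) \<le> norm (z - \<zeta>)"
    by - (rule power2_le_imp_le, simp_all)
  have "z / (z - \<zeta>) + of_real (r\<^sup>2 / (1 - r\<^sup>2))
      = (z * (1 - of_real r ^ 2) + of_real r ^ 2 * (z - \<zeta>)) / ((z - \<zeta>) * (1 - of_real r ^ 2))"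
    using nz by (simp add: add_frac_eq)
  also have "z * (1 - of_real r ^ 2) + of_real r ^ 2 * (z - \<zeta>) = z * (1 - cnj z * \<zeta>)"
    unfolding zz by algebra
  finally have "norm (z / (z - \<zeta>) + of_real (r\<^sup>2 / (1 - r\<^sup>2)))
      = r * norm (1 - cnj z * \<zeta>) / (norm (z - \<zeta>) * norm (1 - complex_of_real r ^ 2))"
    by (simp add: norm_divide norm_mult r_def)
  also have "norm (1 - complex_of_real r ^ 2) = 1 - r\<^sup>2"
    using r2 norm_of_real[of "1 - r\<^sup>2", where 'a = complex] by simp
  also have "r * norm (1 - cnj z * \<zeta>) / (norm (z - \<zeta>) * (1 - r\<^sup>2))
      \<le> r * norm (z - \<zeta>) / (norm (z - \<zeta>) * (1 - r\<^sup>2))"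
    using * r2 by (intro divide_right_mono mult_left_mono mult_nonneg_nonneg) (auto simp: r_def)
  also have "\<dots> = r / (1 - r\<^sup>2)"
    using nz by simp
  finally show ?thesis .
qed

text \<open>Induction on the degree: splitting off a root makes the logarithmic derivative a sum,
  and the centres and radii of the discs add.\<close>

lemma poly_log_derivative_disc:
  fixes Q :: "complex poly"
  assumes "degree Q = n" "Q \<noteq> 0" "\<And>\<zeta>. poly Q \<zeta> = 0 \<Longrightarrow> norm \<zeta> \<ge> 1" and z: "norm z < 1"
  defines "r \<equiv> norm z"
  shows "norm (z * poly (pderiv Q) z / poly Q z + of_real (of_nat n * (r\<^sup>2 / (1 - r\<^sup>2))))
    \<le> of_nat n * (r / (1 - r\<^sup>2))"
  using assms(1-3)
proof (induction n arbitrary: Q)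
  case 0
  then obtain c where "Q = [:c:]"
    by (metis degree_eq_zeroE)
  then show ?case
    by simp
next
  case (Suc n)
  then have "\<not> constant (poly Q)"
    by (simp add: constant_degree)
  then obtain \<zeta> where \<zeta>: "poly Q \<zeta> = 0"
    using Fundamental_Theorem_Algebra.fundamental_theorem_of_algebra by blast
  then obtain P where Q: "Q = [:-\<zeta>, 1:] * P"
    by (metis dvdE poly_eq_0_iff_dvd)
  have P0: "P \<noteq> 0"
    using Q Suc.prems by auto
  have "degree P = n"
    using Suc.prems(1) P0 unfolding Q by (subst (asm) degree_mult_eq) auto
  then have IH: "norm (z * poly (pderiv P) z / poly P z + of_real (of_nat n * (r\<^sup>2 / (1 - r\<^sup>2))))
      \<le> of_nat n * (r / (1 - r\<^sup>2))"
    using Suc.prems P0 by (intro Suc.IH) (auto simp: Q)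
  have "poly Q z \<noteq> 0"
    using Suc.prems(3) z by force
  then have nz: "z - \<zeta> \<noteq> 0" "poly P z \<noteq> 0"
    by (auto simp: Q)
  have "z * poly (pderiv Q) z / poly Q z = z / (z - \<zeta>) + z * poly (pderiv P) z / poly P z"
    unfolding Q pderiv_mult using nz by (simp add: pderiv_pCons field_simps del: mult_pCons_left)
  then have "z * poly (pderiv Q) z / poly Q z + of_real (of_nat (Suc n) * (r\<^sup>2 / (1 - r\<^sup>2)))
     = (z / (z - \<zeta>) + of_real (r\<^sup>2 / (1 - r\<^sup>2)))
       + (z * poly (pderiv P) z / poly P z + of_real (of_nat n * (r\<^sup>2 / (1 - r\<^sup>2))))"
    by (simp add: algebra_simps add_divide_distrib)
  also have "norm \<dots> \<le> r / (1 - r\<^sup>2) + of_nat n * (r / (1 - r\<^sup>2))"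
    unfolding r_def using Suc.prems(3)[OF \<zeta>] z IH
    by (intro norm_triangle_mono log_derivative_factor_disc) (auto simp: r_def)
  finally show ?case
    by (simp add: algebra_simps add_divide_distrib)
qed

section \<open>Quotients of the functions in the family and of their dilations\<close>

text \<open>Differentiating \<open>exp (L z) = q z\<close> gives L' = q'/q, so p'/p = c q'/q
  whichever logarithm \<open>L\<close> was chosen.\<close>

lemma power_branch_has_derivative:
  assumes pb: "power_branch q c p" and q: "\<And>z. z \<in> unit_disc \<Longrightarrow> (q has_field_derivative q' z) (at z)"
    and z: "z \<in> unit_disc"
  shows "(p has_field_derivative of_real c * q' z / q z * p z) (at z)" "p z \<noteq> 0"
proof -
  obtain L where L: "L holomorphic_on unit_disc"
      "\<And>z. z \<in> unit_disc \<Longrightarrow> exp (L z) = q z" "\<And>z. z \<in> unit_disc \<Longrightarrow> p z = exp (of_real c * L z)"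
    using pb unfolding power_branch_def by blast
  show "p z \<noteq> 0"
    using L(3)[OF z] by simp
  have DL: "(L has_field_derivative deriv L z) (at z)"
    using L(1) z by (intro holomorphic_derivI) auto
  then have "((\<lambda>z. exp (L z)) has_field_derivative exp (L z) * deriv L z) (at z)"
    by (auto intro!: derivative_eq_intros)
  then have "(q has_field_derivative exp (L z) * deriv L z) (at z)"
    by (rule has_field_derivative_transform_within_open[where S = unit_disc]) (use z L(2) in auto)
  then have "q' z = q z * deriv L z"
    using q[OF z] L(2)[OF z] by (metis DERIV_unique)
  moreover have "q z \<noteq> 0"
    using L(2)[OF z] by auto
  ultimately have dL: "deriv L z = q' z / q z"
    by simp
  have "((\<lambda>z. exp (of_real c * L z)) has_field_derivative exp (of_real c * L z) * (of_real c * deriv L z)) (at z)"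
    using DL by (auto intro!: derivative_eq_intros)
  then have "(p has_field_derivative exp (of_real c * L z) * (of_real c * deriv L z)) (at z)"
    by (rule has_field_derivative_transform_within_open[where S = unit_disc]) (use z L(3) in auto)
  then show "(p has_field_derivative of_real c * q' z / q z * p z) (at z)"
    using L(3)[OF z] by (simp add: dL mult_ac)
qed

text \<open>Logarithmic derivatives of products add. At 0 the polynomial term vanishes and both
  quotients are 1 by convention.\<close>

lemma starlike_product:
  assumes f: "f \<in> class_A" "\<forall>z\<in>unit_disc - {0}. f z \<noteq> 0"
    and pb: "power_branch (poly Q) c p"
    and F: "\<forall>z\<in>unit_disc. F z = f z * p z"
  shows "F \<in> class_A"
    and "\<forall>z\<in>unit_disc - {0}. F z \<noteq> 0"
    and "\<And>z. z \<in> unit_disc \<Longrightarrow> starlike_quotient F z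
      = starlike_quotient f z + of_real c * (z * poly (pderiv Q) z / poly Q z)"
proof -
  have f': "f holomorphic_on unit_disc" "f 0 = 0" "deriv f 0 = 1"
    using f(1) by (auto simp: class_A_def)
  note p = power_branch_has_derivative[OF pb poly_DERIV]
  have D: "(F has_field_derivative deriv f z * p z + of_real c * poly (pderiv Q) z / poly Q z * p z * f z) (at z)"
    if z: "z \<in> unit_disc" for z
  proof -
    have "(f has_field_derivative deriv f z) (at z)"
      using f' z by (intro holomorphic_derivI) auto
    from DERIV_mult[OF this p(1)[OF z]] show ?thesis
      by (rule has_field_derivative_transform_within_open[where S = unit_disc]) (use z F in auto)
  qed
  show "\<forall>z\<in>unit_disc - {0}. F z \<noteq> 0"
    using F f p by simp
  have "p 0 = 1"
    using pb by (simp add: power_branch_def)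
  moreover have "F holomorphic_on unit_disc"
    unfolding holomorphic_on_open[OF open_ball] using D by blast
  ultimately show "F \<in> class_A"
    using F f' DERIV_imp_deriv[OF D[of 0]] by (simp add: class_A_def)
  show "starlike_quotient F z
      = starlike_quotient f z + of_real c * (z * poly (pderiv Q) z / poly Q z)" if z: "z \<in> unit_disc" for z
  proof (cases "z = 0")
    case False
    have *: "f z \<noteq> 0" "p z \<noteq> 0"
      using f(2) p(2) z False by auto
    have "starlike_quotient F z
      = z * (deriv f z * p z + of_real c * poly (pderiv Q) z / poly Q z * p z * f z) / (f z * p z)"
      unfolding starlike_quotient_def using False F z DERIV_imp_deriv[OF D[OF z]] by simp
    then show ?thesis
      using * False by (simp add: starlike_quotient_def add_divide_distrib distrib_left)
  qed (simp add: starlike_quotient_def)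
qed

lemma family_F_bound:
  assumes F: "F \<in> family_F \<alpha> \<beta> n" and \<alpha>: "0 \<le> \<alpha>" "\<alpha> < 1" and "\<beta> > 0" "n \<ge> 1"
  shows "F \<in> class_A"
    and "\<forall>z\<in>unit_disc - {0}. F z \<noteq> 0"
    and "\<And>z. z \<in> unit_disc \<Longrightarrow> norm (starlike_quotient F z - 1)
      \<le> ((2 - 2 * \<alpha> + \<beta>) * norm z + \<bar>2 - 2 * \<alpha> - \<beta>\<bar> * (norm z)\<^sup>2) / (1 - (norm z)\<^sup>2)"
proof -
  obtain f Q p where f: "f \<in> starlike_of_order \<alpha>"
    and Q: "degree Q = n" "poly Q 0 = 1" "\<And>z. poly Q z = 0 \<Longrightarrow> z \<notin> unit_disc"
    and pb: "power_branch (poly Q) (\<beta> / real n) p"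
    and Feq: "\<forall>z\<in>unit_disc. F z = f z * p z"
    using F unfolding family_F_def by blast
  have fA: "f \<in> class_A"
    using f by (simp add: starlike_of_order_def)
  note product = starlike_product[OF fA starlike_of_order_nonzero[OF f \<alpha>(1)] pb Feq]
  show "F \<in> class_A" "\<forall>z\<in>unit_disc - {0}. F z \<noteq> 0"
    using product by auto
  fix z :: complex
  assume z: "z \<in> unit_disc"
  define r where "r = norm z"
  have r2: "r\<^sup>2 < 1"
    using z by (simp add: r_def abs_square_less_1)
  define S where "S = starlike_quotient f z - 1"
  define T where "T = z * poly (pderiv Q) z / poly Q z"
  \<comment> \<open>Up to sign, \<open>s\<close> is the centre and \<open>t\<close> the radius of
    the disc for a single linear factor.\<close>
  define s where "s = r\<^sup>2 / (1 - r\<^sup>2)"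
  define t where "t = r / (1 - r\<^sup>2)"
  have "Q \<noteq> 0"
    using Q(2) by auto
  then have "norm (T + of_real (of_nat n * s)) \<le> of_nat n * t"
    unfolding T_def r_def s_def t_def using Q z by (intro poly_log_derivative_disc) force+
  then have "\<beta> / n * norm (T + of_real (of_nat n * s)) \<le> \<beta> / n * (of_nat n * t)"
    using \<open>\<beta> > 0\<close> by (intro mult_left_mono) auto
  also have "\<beta> / n * norm (T + of_real (of_nat n * s)) = norm (of_real (\<beta> / n) * (T + of_real (of_nat n * s)))"
    using \<open>\<beta> > 0\<close> by (simp add: norm_mult norm_divide)
  also have "of_real (\<beta> / n) * (T + of_real (of_nat n * s)) = of_real (\<beta> / n) * T + of_real (\<beta> * s)"
    using \<open>n \<ge> 1\<close> by (simp add: field_simps)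
  finally have T: "norm (of_real (\<beta> / n) * T + of_real (\<beta> * s)) \<le> \<beta> * t"
    using \<open>n \<ge> 1\<close> by simp
  have S: "norm (S - of_real (2 * (1 - \<alpha>) * s)) \<le> 2 * (1 - \<alpha>) * t"
    using starlike_of_order_disc[OF f \<alpha> z] by (simp add: S_def s_def t_def r_def)
  have "0 \<le> s"
    using r2 by (simp add: s_def)
  \<comment> \<open>Two deviations from disc centres, plus the sum of the centres. The centres have
    opposite signs, so only their difference enters, in absolute value, while the radii add.\<close>
  have "starlike_quotient F z - 1
      = (S - of_real (2 * (1 - \<alpha>) * s)) + (of_real (\<beta> / n) * T + of_real (\<beta> * s))
        + of_real ((2 - 2 * \<alpha> - \<beta>) * s)"
    unfolding product(3)[OF z] by (simp add: S_def T_def algebra_simps)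
  also have "norm \<dots> \<le> 2 * (1 - \<alpha>) * t + \<beta> * t + \<bar>2 - 2 * \<alpha> - \<beta>\<bar> * s"
    using S T \<open>0 \<le> s\<close>
    by (intro norm_triangle_mono) (simp_all only: norm_of_real abs_mult abs_of_nonneg order_refl)
  also have "\<dots> = ((2 - 2 * \<alpha> + \<beta>) * r + \<bar>2 - 2 * \<alpha> - \<beta>\<bar> * r\<^sup>2) / (1 - r\<^sup>2)"
    by (simp add: s_def t_def flip: add_divide_distrib) (simp add: algebra_simps)
  finally show "norm (starlike_quotient F z - 1)
      \<le> ((2 - 2 * \<alpha> + \<beta>) * norm z + \<bar>2 - 2 * \<alpha> - \<beta>\<bar> * (norm z)\<^sup>2) / (1 - (norm z)\<^sup>2)"
    by (simp add: r_def)
qed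

text \<open>The factors of \<open>r\<close> cancel in the quotient, so membership of the dilation
  depends on the quotient of \<open>F\<close> over the smaller disc.\<close>

lemma starlike_dilation:
  assumes F: "F \<in> class_A" "\<forall>z\<in>unit_disc - {0}. F z \<noteq> 0" and r: "0 < r" "r < 1"
  defines "G \<equiv> \<lambda>z. inverse (of_real r) * F (of_real r * z)"
  shows "G \<in> class_A"
    and "\<forall>z\<in>unit_disc - {0}. G z \<noteq> 0"
    and "\<And>z. z \<in> unit_disc \<Longrightarrow> starlike_quotient G z = starlike_quotient F (of_real r * z)"
proof -
  have F': "F holomorphic_on unit_disc" "F 0 = 0" "deriv F 0 = 1"
    using F(1) by (auto simp: class_A_def)
  have mem: "of_real r * z \<in> unit_disc" if "z \<in> unit_disc" for z
    using that r mult_strict_mono[of r 1 "norm z" 1] by (simp add: norm_mult)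
  have D: "(G has_field_derivative deriv F (of_real r * z)) (at z)" if z: "z \<in> unit_disc" for z
  proof -
    have "(F has_field_derivative deriv F (of_real r * z)) (at (of_real r * z))"
      using F' mem[OF z] by (intro holomorphic_derivI) auto
    then have "((\<lambda>z. F (of_real r * z)) has_field_derivative deriv F (of_real r * z) * of_real r) (at z)"
      by (rule DERIV_chain2) (auto intro!: derivative_eq_intros)
    then show ?thesis
      unfolding G_def using r by (auto intro!: derivative_eq_intros)
  qed
  have "G holomorphic_on unit_disc"
    unfolding holomorphic_on_open[OF open_ball] using D by blast
  moreover have "G 0 = 0"
    using F' by (simp add: G_def)
  ultimately show "G \<in> class_A"
    using F' DERIV_imp_deriv[OF D[of 0]] by (simp add: class_A_def)
  show "\<forall>z\<in>unit_disc - {0}. G z \<noteq> 0"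
    using F(2) mem r by (auto simp: G_def)
  show "starlike_quotient G z = starlike_quotient F (of_real r * z)" if z: "z \<in> unit_disc" for z
    unfolding starlike_quotient_def using DERIV_imp_deriv[OF D[OF z]] r
    by (auto simp: G_def field_simps)
qed

section \<open>The extremal function\<close>

text \<open>This is the generalised Koebe function z / (1 - z)^(2 - 2 \<alpha>). \<open>Ln\<close>
  supplies the power, since 1 - z stays in the right half-plane.\<close>

lemma extremal_in_starlike_of_order:
  assumes "\<alpha> < 1"
  defines "f \<equiv> \<lambda>z. z * exp (- of_real (2 - 2 * \<alpha>) * Ln (1 - z))"
  shows "f \<in> starlike_of_order \<alpha>"
    and "\<And>z. z \<in> unit_disc \<Longrightarrow> starlike_quotient f z = 1 + of_real (2 - 2 * \<alpha>) * (z / (1 - z))"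
proof -
  define c where "c = complex_of_real (2 - 2 * \<alpha>)"
  have re: "Re (1 - z) > 0" if "z \<in> unit_disc" for z
    using that complex_Re_le_cmod[of z] by simp
  have D: "(f has_field_derivative (1 + c * (z / (1 - z))) * exp (- c * Ln (1 - z))) (at z)"
    if z: "z \<in> unit_disc" for z
  proof -
    have "1 - z \<noteq> 0" "1 - z \<notin> \<real>\<^sub>\<le>\<^sub>0"
      using re[OF z] by (auto simp: complex_nonpos_Reals_iff)
    then show ?thesis
      unfolding f_def c_def[symmetric]
      by (auto intro!: derivative_eq_intros simp: field_simps)
  qed
  show q: "starlike_quotient f z = 1 + complex_of_real (2 - 2 * \<alpha>) * (z / (1 - z))" if z: "z \<in> unit_disc" for z
  proof -
    have "f z = z * exp (- c * Ln (1 - z))"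
      by (simp only: f_def c_def)
    then show ?thesis
      using DERIV_imp_deriv[OF D[OF z]] by (simp only: starlike_quotient_def flip: c_def) simp
  qed
  have "f holomorphic_on unit_disc"
    unfolding holomorphic_on_open[OF open_ball] using D by blast
  then have "f \<in> class_A"
    using DERIV_imp_deriv[OF D[of 0]] by (simp add: class_A_def f_def)
  moreover have "Re (starlike_quotient f z) > \<alpha>" if z: "z \<in> unit_disc" for z
  proof -
    have nz: "1 - z \<noteq> 0"
      using re[OF z] by force
    \<comment> \<open>The map 1/(1 - z) sends the disc into Re > 1/2: the inequality
      \<open>norm z ^ 2 < 1\<close> says that the squared modulus of 1 - z is less than 2 Re (1 -
      z).\<close>
    have "norm z ^ 2 < 1"
      using z by (simp add: abs_square_less_1)
    then have "(1 - Re z)\<^sup>2 + (Im z)\<^sup>2 < 2 * (1 - Re z)"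
      unfolding cmod_power2 by (simp add: power2_eq_square algebra_simps)
    moreover have "(1 - Re z)\<^sup>2 + (Im z)\<^sup>2 > 0"
      using re[OF z] by (simp add: add_pos_nonneg)
    ultimately have "(1 - Re z) / ((1 - Re z)\<^sup>2 + (Im z)\<^sup>2) > 1 / 2"
      by (simp add: field_simps)
    then have "Re (inverse (1 - z)) > 1 / 2"
      by simp
    moreover have "z / (1 - z) = inverse (1 - z) - 1"
      using nz by (simp add: field_simps)
    ultimately have "Re (z / (1 - z)) > - 1 / 2"
      by (simp del: inverse_complex.sel)
    then have "(2 - 2 * \<alpha>) * (- 1 / 2) < (2 - 2 * \<alpha>) * Re (z / (1 - z))"
      using \<open>\<alpha> < 1\<close> by (intro mult_strict_left_mono) auto
    moreover have "(2 - 2 * \<alpha>) * (- 1 / 2) = \<alpha> - 1"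
      by (simp add: field_simps)
    moreover define t where "t = (2 - 2 * \<alpha>) * Re (z / (1 - z))"
    ultimately have "\<alpha> < 1 + t"
      by simp
    moreover have "Re (complex_of_real a * w) = a * Re w" for a w
      by simp
    ultimately show ?thesis
      unfolding q[OF z] t_def by (simp only: plus_complex.sel one_complex.sel)
  qed
  ultimately show "f \<in> starlike_of_order \<alpha>"
    by (simp add: starlike_of_order_def)
qed

text \<open>With every zero of \<open>Q\<close> at -1, the terms from \<open>f\<close> and from
  \<open>Q\<close> reach the same end of their discs at a real point: the right end for x > 0, the
  left end for x < 0. Hence the bounds are attained simultaneously.\<close>

lemma family_F_extremal:
  assumes \<alpha>: "0 \<le> \<alpha>" "\<alpha> < 1" and "n \<ge> 1"
  obtains F where "F \<in> family_F \<alpha> \<beta> n"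
    and "\<And>x. \<bar>x\<bar> < 1 \<Longrightarrow> starlike_quotient F (of_real x)
      = of_real (1 + ((2 - 2 * \<alpha> + \<beta>) * x + (2 - 2 * \<alpha> - \<beta>) * x\<^sup>2) / (1 - x\<^sup>2))"
proof -
  define f where "f z = z * exp (- of_real (2 - 2 * \<alpha>) * Ln (1 - z))" for z
  define Q :: "complex poly" where "Q = [:1, 1:] ^ n"
  \<comment> \<open>The logarithm of \<open>Q\<close> used here is n times
    \<open>Ln (1 + z)\<close>, holomorphic on the disc even where \<open>Q\<close> crosses the
    negative real axis.\<close>
  define p where "p z = exp (of_real (\<beta> / n) * (of_nat n * Ln (1 + z)))" for z
  note f = extremal_in_starlike_of_order[OF \<alpha>(2), folded f_def]
  have re: "Re (1 + z) > 0" if "z \<in> unit_disc" for z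
    using that abs_Re_le_cmod[of z] by simp
  have nz: "1 + z \<noteq> 0" if "z \<in> unit_disc" for z
    using re[OF that] by force
  have "exp (of_nat n * Ln (1 + z)) = poly Q z" if "z \<in> unit_disc" for z
    using nz[OF that] by (simp add: Q_def exp_of_nat_mult)
  moreover have "(\<lambda>z. of_nat n * Ln (1 + z)) holomorphic_on unit_disc"
    using re by (intro holomorphic_intros) (force simp: complex_nonpos_Reals_iff)
  ultimately have pb: "power_branch (poly Q) (\<beta> / n) p"
    unfolding power_branch_def p_def
    by (intro conjI exI[of _ "\<lambda>z. of_nat n * Ln (1 + z)"]) auto
  have "(\<lambda>z. f z * p z) \<in> family_F \<alpha> \<beta> n"
    unfolding family_F_def mem_Collect_eq
  proof (intro exI conjI)
    show "degree Q = n"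
      by (simp add: Q_def degree_power_eq)
    show "\<forall>z. poly Q z = 0 \<longrightarrow> z \<notin> unit_disc"
      using nz by (auto simp: Q_def)
  qed (use f pb in \<open>auto simp: Q_def\<close>)
  moreover have "starlike_quotient (\<lambda>z. f z * p z) (of_real x)
      = of_real (1 + ((2 - 2 * \<alpha> + \<beta>) * x + (2 - 2 * \<alpha> - \<beta>) * x\<^sup>2) / (1 - x\<^sup>2))" if "\<bar>x\<bar> < 1" for x :: real
  proof -
    have x: "1 + x \<noteq> 0" "1 - x \<noteq> 0" "1 - x\<^sup>2 \<noteq> 0"
      using that abs_square_less_1[of x] by auto
    have "f \<in> class_A"
      using f(1) by (simp add: starlike_of_order_def)
    from starlike_product(3)[OF this starlike_of_order_nonzero[OF f(1) \<alpha>(1)] pb ballI[OF refl], of "of_real x"]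
    have "starlike_quotient (\<lambda>z. f z * p z) (of_real x) = 1 + of_real (2 - 2 * \<alpha>) * (of_real x / (1 - of_real x))
      + of_real (\<beta> / n) * (of_real x * poly (pderiv Q) (of_real x) / poly Q (of_real x))"
      using that f(2)[of "of_real x"] by simp
    also have "of_real x * poly (pderiv Q) (of_real x) / poly Q (of_real x)
      = of_real x * (of_nat n / (1 + complex_of_real x))"
    proof -
      obtain k where k: "n = Suc k"
        using \<open>n \<ge> 1\<close> by (cases n) auto
      have "pderiv Q = smult (of_nat n) ([:1, 1:] ^ k)"
        by (simp only: Q_def k pderiv_power_Suc) (simp add: pderiv_pCons)
      then have "poly (pderiv Q) (of_real x) = of_nat n * (1 + of_real x) ^ k"
        by simp
      moreover have "poly Q (of_real x) = (1 + of_real x) ^ n"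
        by (simp add: Q_def)
      moreover have "1 + complex_of_real x \<noteq> 0"
        using x(1) by (metis of_real_1 of_real_add of_real_eq_0_iff)
      ultimately show ?thesis
        by (simp add: k)
    qed
    finally have "starlike_quotient (\<lambda>z. f z * p z) (of_real x)
      = of_real (1 + (2 - 2 * \<alpha>) * (x / (1 - x)) + \<beta> / n * (x * (n / (1 + x))))"
      by simp
    also have "1 + (2 - 2 * \<alpha>) * (x / (1 - x)) + \<beta> / n * (x * (n / (1 + x)))
      = 1 + ((2 - 2 * \<alpha> + \<beta>) * x + (2 - 2 * \<alpha> - \<beta>) * x\<^sup>2) / (1 - x\<^sup>2)"
    proof -
      have "1 - x\<^sup>2 = (1 - x) * (1 + x)"
        by (simp add: power2_eq_square algebra_simps)
      then show ?thesis
        using x \<open>n \<ge> 1\<close> by (simp add: divide_simps power2_eq_square) (simp add: algebra_simps)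
    qed
    finally show ?thesis .
  qed
  ultimately show ?thesis
    by (rule that)
qed

section \<open>The radius as the root of a quadratic\<close>

text \<open>The usual root formula with its numerator rationalised, the shape in which the radius is
  stated.\<close>

lemma quadratic_positive_root:
  fixes a b k :: real
  assumes "0 < a" "0 < b" "0 < k"
  defines "\<sigma> \<equiv> 2 * k / (a + sqrt (a\<^sup>2 + 4 * k * b))"
  shows "\<sigma> > 0" "a * \<sigma> + b * \<sigma>\<^sup>2 = k"
proof -
  define t where "t = a + sqrt (a\<^sup>2 + 4 * k * b)"
  have "t > 0"
    using assms(1-3) by (simp add: t_def add_pos_nonneg)
  then show "\<sigma> > 0"
    using assms(3) by (simp add: \<sigma>_def t_def)
  have "(t - a)\<^sup>2 = a\<^sup>2 + 4 * k * b"
    using assms(1-3) by (simp add: t_def)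
  \<comment> \<open>This is the quadratic equation for 2k/t, multiplied by the square of
    \<open>t\<close>.\<close>
  then have "2 * k * (a * t + 2 * b * k) = k * t\<^sup>2"
    by (simp add: power2_eq_square algebra_simps)
  moreover have "\<sigma> * t = 2 * k"
    using \<open>t > 0\<close> by (simp add: \<sigma>_def t_def)
  ultimately have "(a * \<sigma> + b * \<sigma>\<^sup>2) * t\<^sup>2 = k * t\<^sup>2"
    by algebra
  then show "a * \<sigma> + b * \<sigma>\<^sup>2 = k"
    using \<open>t > 0\<close> by simp
qed

theorem theorem7p2:
  fixes \<alpha> \<beta> e \<sigma>\<^sub>0 \<sigma>\<^sub>1 :: real and n :: nat
  assumes "0 \<le> \<alpha>" and "\<alpha> < 1" and "\<beta> > 0" and "n \<ge> 1"
    and "e = exp 1"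
    and "\<sigma>\<^sub>0 = 2 * (e - 1) /
           ((2 - 2 * \<alpha> + \<beta>) * (e + 1) +
            sqrt (((e + 1) * (2 - 2 * \<alpha> + \<beta>))\<^sup>2
              - 4 * (e - 1) * (3 + e - 2 * \<alpha> - 2 * \<alpha> * e - \<beta> - \<beta> * e)))"
    and "\<sigma>\<^sub>1 = 2 * (e - 1) /
           ((2 - 2 * \<alpha> + \<beta>) * (e + 1) +
            sqrt (((e + 1) * (2 - 2 * \<alpha> + \<beta>))\<^sup>2
              + 4 * (e - 1) * (1 + 3 * e - 2 * \<alpha> - 2 * \<alpha> * e - \<beta> - \<beta> * e)))"
  shows "is_class_radius starlike_SG (family_F \<alpha> \<beta> n)
           (if 2 * \<alpha> + \<beta> - 2 \<ge> 0 then \<sigma>\<^sub>0 else \<sigma>\<^sub>1)"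
proof -
  define c where "c = 2 - 2 * \<alpha> + \<beta>"
  define m where "m = \<bar>2 - 2 * \<alpha> - \<beta>\<bar>"
  \<comment> \<open>Clearing denominators in (c x + m x^2)/(1 - x^2) = (e - 1)/(e + 1) gives c (e +
    1) x + b x^2 = e - 1.\<close>
  define b where "b = m * (e + 1) + (e - 1)"
  define \<sigma> where "\<sigma> = (if 2 * \<alpha> + \<beta> - 2 \<ge> 0 then \<sigma>\<^sub>0 else \<sigma>\<^sub>1)"
  have e: "e > 1"
    using assms(5) by simp
  have c: "c > 0" and m: "m \<ge> 0"
    using assms by (auto simp: c_def m_def)
  have b: "b > 0"
    using e m by (simp add: b_def add_nonneg_pos)
  have "\<sigma> = 2 * (e - 1) / (c * (e + 1) + sqrt ((c * (e + 1))\<^sup>2 + 4 * (e - 1) * b))"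
  \<comment> \<open>Both stated formulas are this root: the bracket under the square root is -b or b
    according to the sign resolved in \<open>m\<close>.\<close>
  proof (cases "2 * \<alpha> + \<beta> - 2 \<ge> 0")
    case True
    then have "3 + e - 2 * \<alpha> - 2 * \<alpha> * e - \<beta> - \<beta> * e = - b"
      by (simp add: b_def m_def algebra_simps)
    then show ?thesis
      using True by (simp only: \<sigma>_def assms(6) flip: c_def) (simp add: mult.commute)
  next
    case False
    then have "1 + 3 * e - 2 * \<alpha> - 2 * \<alpha> * e - \<beta> - \<beta> * e = b"
      by (simp add: b_def m_def algebra_simps)
    then show ?thesis
      using False by (simp only: \<sigma>_def assms(7) flip: c_def) (simp add: mult.commute)
  qed
  then have \<sigma>: "\<sigma> > 0" "c * (e + 1) * \<sigma> + b * \<sigma>\<^sup>2 = e - 1"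
    using quadratic_positive_root[of "c * (e + 1)" b "e - 1"] c b e by auto
  have mono: "c * (e + 1) * x + b * x\<^sup>2 < c * (e + 1) * y + b * y\<^sup>2" if "0 \<le> x" "x < y" for x y
    using that c b e by (intro add_strict_mono mult_strict_left_mono power_strict_mono) auto
  \<comment> \<open>At 1 the increasing quadratic already exceeds e - 1, so its root lies below
    1.\<close>
  have "e - 1 < c * (e + 1) * 1 + b * 1\<^sup>2"
    using c e m by (simp add: b_def add_pos_nonneg)
  then have \<sigma>1: "\<sigma> < 1"
    using mono[of 1 \<sigma>] \<sigma> by (cases \<sigma> "1 :: real" rule: linorder_cases) auto
  have quotient: "(c * x + m * x\<^sup>2) / (1 - x\<^sup>2) - (e - 1) / (e + 1)
      = (c * (e + 1) * x + b * x\<^sup>2 - (e - 1)) / ((e + 1) * (1 - x\<^sup>2))" if "0 \<le> x" "x < 1" for x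
  proof -
    have "1 - x\<^sup>2 \<noteq> 0"
      using that abs_square_less_1[of x] by auto
    then show ?thesis
      using e by (simp add: b_def diff_frac_eq) (simp add: algebra_simps)
  qed
  have SG: "(\<lambda>z. inverse (of_real r) * F (of_real r * z)) \<in> starlike_SG"
    if F: "F \<in> family_F \<alpha> \<beta> n" and r: "0 < r" "r < \<sigma>" for F r
  proof -
    let ?G = "\<lambda>z. inverse (of_real r) * F (of_real r * z)"
    note bound = family_F_bound[OF F assms(1-4), folded c_def m_def]
    have r1: "r < 1"
      using r \<sigma>1 by simp
    note dilation = starlike_dilation[OF bound(1,2) r(1) r1]
    have "norm (starlike_quotient ?G z - 1) < (exp 1 - 1) / (exp 1 + 1)" if z: "z \<in> unit_disc" for z
    proof -
      define x where "x = norm (of_real r * z)"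
      have "x = r * norm z"
        using r by (simp add: x_def norm_mult)
      also have "\<dots> \<le> r * 1"
        using r z by (intro mult_left_mono) auto
      finally have x: "0 \<le> x" "x < \<sigma>"
        using r by (auto simp: x_def)
      have "norm (starlike_quotient ?G z - 1) \<le> (c * x + m * x\<^sup>2) / (1 - x\<^sup>2)"
        unfolding dilation(3)[OF z] x_def using x \<sigma>1 by (intro bound(3)) (simp add: x_def)
      moreover have "(c * (e + 1) * x + b * x\<^sup>2 - (e - 1)) / ((e + 1) * (1 - x\<^sup>2)) < 0"
        using mono[OF x] \<sigma> x \<sigma>1 e abs_square_less_1[of x]
        by (intro divide_neg_pos mult_pos_pos) auto
      ultimately show ?thesis
        using quotient[of x] x \<sigma>1 assms(5) by simp
    qed
    then have "subordinate (starlike_quotient ?G) (\<lambda>z. 2 / (1 + exp (- z)))"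
      using dilation
      by (intro subordinate_sigmoidI holomorphic_starlike_quotient) (auto simp: starlike_quotient_def)
    then show ?thesis
      using dilation(1) by (simp add: starlike_SG_def)
  qed
  have sharp: "R \<le> \<sigma>" if R: "R < 1" and adm: "\<And>F r. F \<in> family_F \<alpha> \<beta> n \<Longrightarrow> 0 < r \<Longrightarrow> r < R \<Longrightarrow>
      (\<lambda>z. inverse (of_real r) * F (of_real r * z)) \<in> starlike_SG" for R
  proof (rule ccontr)
    assume "\<not> R \<le> \<sigma>"
    \<comment> \<open>With \<open>r\<close> strictly above \<open>\<sigma>\<close>, the critical
      point of modulus \<open>\<sigma>\<close> is \<open>r * z\<close> for some \<open>z\<close>
      inside the open disc.\<close>
    then obtain r where r: "\<sigma> < r" "r < R"
      using dense[of \<sigma> R] by auto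
    obtain F where F: "F \<in> family_F \<alpha> \<beta> n"
      and SF: "\<And>x. \<bar>x\<bar> < 1 \<Longrightarrow> starlike_quotient F (of_real x)
        = of_real (1 + (c * x + (2 - 2 * \<alpha> - \<beta>) * x\<^sup>2) / (1 - x\<^sup>2))"
      using family_F_extremal[OF assms(1,2,4), of \<beta>, folded c_def] by blast
    let ?G = "\<lambda>z. inverse (of_real r) * F (of_real r * z)"
    \<comment> \<open>The sign \<open>s\<close> selects the end of the real axis at which the shift
      of the centre reinforces the radius, so that the modulus bound is attained there.\<close>
    define s :: real where "s = (if 2 * \<alpha> + \<beta> - 2 \<ge> 0 then - 1 else 1)"
    have s: "s * m = 2 - 2 * \<alpha> - \<beta>" "s\<^sup>2 = 1" "\<bar>s\<bar> = 1"
      by (auto simp: s_def m_def)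
    define z where "z = complex_of_real (s * \<sigma> / r)"
    have z: "z \<in> unit_disc"
      using s r \<sigma> by (simp add: z_def norm_mult norm_divide abs_mult)
    have rz: "of_real r * z = of_real (s * \<sigma>)"
      using r \<sigma> by (simp add: z_def)
    have "starlike_quotient ?G z = starlike_quotient F (of_real (s * \<sigma>))"
      using starlike_dilation(3)[OF family_F_bound(1,2)[OF F assms(1-4)] _ _ z, of r] r R \<sigma>
      by (simp only: rz)
    also have "\<dots> = of_real (1 + (c * (s * \<sigma>) + (2 - 2 * \<alpha> - \<beta>) * (s * \<sigma>)\<^sup>2) / (1 - (s * \<sigma>)\<^sup>2))"
      using s \<sigma> \<sigma>1 by (intro SF) (simp add: abs_mult)
    also have "(s * \<sigma>)\<^sup>2 = \<sigma>\<^sup>2"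
      using s by (simp add: power_mult_distrib)
    also have "c * (s * \<sigma>) + (2 - 2 * \<alpha> - \<beta>) * \<sigma>\<^sup>2 = s * (c * \<sigma> + m * \<sigma>\<^sup>2)"
      unfolding s(1)[symmetric] by (simp add: algebra_simps)
    also have "1 + s * (c * \<sigma> + m * \<sigma>\<^sup>2) / (1 - \<sigma>\<^sup>2) = 1 + s * ((e - 1) / (e + 1))"
      using quotient[of \<sigma>] \<sigma> \<sigma>1 by (simp flip: times_divide_eq_right)
    \<comment> \<open>The sigmoid at \<open>s\<close> is 1 + tanh (s/2); tanh is odd and tanh (1/2)
      = (e - 1)/(e + 1).\<close>
    also have "1 + s * ((e - 1) / (e + 1)) = 2 / (1 + exp (- s))"
      using e by (auto simp: s_def exp_minus field_simps simp flip: assms(5))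
    finally have "starlike_quotient ?G z = 2 / (1 + exp (- complex_of_real s))"
      by (simp flip: exp_of_real)
    then have "\<not> subordinate (starlike_quotient ?G) (\<lambda>z. 2 / (1 + exp (- z)))"
      by (rule not_subordinate_sigmoid[OF z]) (simp add: s)
    then show False
      using adm[OF F, of r] r \<sigma> by (simp add: starlike_SG_def)
  qed
  show ?thesis
    unfolding is_class_radius_def Let_def \<sigma>_def[symmetric]
    using \<sigma>(1) \<sigma>1 SG sharp by blast
qed

end
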